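(* Let $n$ be a positive integer, let $L$ be a list of $n$ positive integers not exceeding $n$, and let $v=2n+1$. Let $S$ be the underlying set of $L$. Then $\mathrm{MPP}(L)$ holds whenever $S$ satisfies one of the following conditions: (1) $|S|=1$, $|S|=2$ or $|S|=n$; (2) $S=\{1,2,t\}$, where $t\geq 3$ is an integer not coprime with $v$. Furthermore, $\mathrm{MPP}(L)$ holds if $L=\{1^a,2^b,t^c\}$, where $t\geq 3$ and $a,b,c\geq 1$ are integers (with $a+b+c=n$), and $a+b\geq \left\lfloor\frac{t-1}{2}\right\rfloor$.
   Context: $K_v$ denotes the complete graph on the vertex set $\{0,1,\dots,v-1\}$. The length of an edge $[x,y]$ of $K_v$ is $\ell(x,y)=\min(|x-y|,\,v-|x-y|)$. For a subgraph $\Gamma$ of $K_v$, $\ell(\Gamma)$ is the multiset (list) of the lengths of all edges of $\Gamma$, taken with multiplicity. A near $1$-factor of $K_{2n+1}$ is a subgraph consisting of $n$ pairwise disjoint edges and one isolated vertex. "List" means multiset; $\{x_1^{a_1},\dots,x_k^{a_k}\}$ denotes the list containing $a_i$ copies of $x_i$ for each $i$; the underlying set of a list is the set of its distinct elements. For a list $L$ of $n$ positive integers not exceeding $n$, with $v=2n+1$, "$\mathrm{MPP}(L)$ holds" means that the following equivalence is true: there exists a near $1$-factor $F$ of $K_v$ with $\ell(F)=L$ if and only if, for every positive divisor $d$ of $v$, the number of multiples of $d$ appearing in $L$ (counted with multiplicity) does not exceed $\frac{v-d}{2}$. *)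

theory Defs
  imports Complex_Main "HOL-Library.Multiset"
begin

definition complete_edges :: "nat \<Rightarrow> nat set set" where
  "complete_edges v = {{x, y} | x y. x < v \<and> y < v \<and> x \<noteq> y}"

text \<open>
  Truncated subtraction is harmless in the next two definitions: for the two ends \<open>x\<close> and
  \<open>y\<close> of an edge, \<open>Max e - Min e\<close> is \<open>\<bar>x - y\<bar>\<close>, and it is less than \<open>v\<close>
  (see \<open>edge_length_pair\<close>).
\<close>

definition edge_length :: "nat \<Rightarrow> nat set \<Rightarrow> nat" where
  "edge_length v e = min (Max e - Min e) (v - (Max e - Min e))"

lemma edge_length_pair:
  assumes "x < v" "y < v"
  shows "int (edge_length v {x, y}) = min \<bar>int x - int y\<bar> (int v - \<bar>int x - int y\<bar>)"
  using assms by (auto simp: edge_length_def min_def max_def)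

definition length_list :: "nat \<Rightarrow> nat set set \<Rightarrow> nat multiset" where
  "length_list v E = image_mset (edge_length v) (mset_set E)"

text \<open>
  A near 1-factor of the complete graph on \<open>{..<2 * n + 1}\<close> is a spanning subgraph, so it is
  represented by its edge set; the isolated vertex is the one that no edge covers.
\<close>

definition near_1_factor :: "nat \<Rightarrow> nat set set \<Rightarrow> bool" where
  "near_1_factor n F \<longleftrightarrow>
     F \<subseteq> complete_edges (2 * n + 1) \<and> card F = n \<and>
     (\<forall>e \<in> F. \<forall>e' \<in> F. e \<noteq> e' \<longrightarrow> e \<inter> e' = {}) \<and>
     (\<exists>!w. w < 2 * n + 1 \<and> w \<notin> \<Union> F)"

text \<open>
  The Meszka-Pasotti-Pellegrini equivalence for a list \<open>L\<close> of \<open>n\<close> positive integers not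
  exceeding \<open>n\<close>; these requirements on \<open>L\<close> are not part of the predicate.
\<close>

definition MPP :: "nat \<Rightarrow> nat multiset \<Rightarrow> bool" where
  "MPP n L \<longleftrightarrow>
     (let v = 2 * n + 1 in
       (\<exists>F. near_1_factor n F \<and> length_list v F = L) \<longleftrightarrow>
       (\<forall>d. 0 < d \<and> d dvd v \<longrightarrow>
          real (size {#x \<in># L. d dvd x#}) \<le> (real v - real d) / 2))"

end

theory Submission
  imports Defs "HOL-Number_Theory.Cong"
begin

text \<open>
  Necessity: an edge whose length is a multiple of \<open>d\<close> joins two vertices of the same class modulo
  \<open>d\<close>, and each of the \<open>d\<close> classes has the odd size \<open>v / d\<close>, so it contains at most
  \<open>(v / d - 1) / 2\<close> disjoint edges.

  Sufficiency rests on two arrangements of the residues modulo \<open>v\<close>. If \<open>x\<close> is coprime to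
  \<open>v\<close>, the multiples of \<open>x\<close> form a path on which a length \<open>y\<close> becomes a shift by some
  \<open>t \<le> n\<close>; the \<open>t\<close>-edges are packed into full blocks of \<open>2 t\<close> consecutive cells and one
  partial block, which leaves two intervals, exactly one of them of odd size, to be matched by
  edges of length 1 and 2. If \<open>gcd x v = d > 1\<close>, the cosets of \<open>x\<close> are the rows of a
  \<open>d \<times> v / d\<close> grid with both sides odd: one or three columns are matched almost
  vertically, and in the remaining columns, taken in adjacent pairs, pairs of horizontal edges are
  traded for pairs of vertical ones. For two lengths these arrangements, used for either length,
  cover all admissible multiplicities. For lengths 1, 2 and \<open>t\<close>, the path applies when
  \<open>a + b \<ge> \<lfloor>(t - 1) / 2\<rfloor>\<close>, and the grid otherwise.
\<close>

section \<open>Perfect matchings with labelled edges\<close>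

text \<open>A perfect matching of \<open>A\<close> together with its multiset of labels. Keeping the
  edge relation \<open>E\<close> abstract lets intervals, grids and residues share one
  notion.\<close>

inductive matched :: "('a \<Rightarrow> 'a \<Rightarrow> 'l \<Rightarrow> bool) \<Rightarrow> 'a set \<Rightarrow> 'l multiset \<Rightarrow> bool"
  for E where
  empty: "matched E {} {#}"
| add: "matched E A M \<Longrightarrow> x \<notin> A \<Longrightarrow> y \<notin> A \<Longrightarrow> x \<noteq> y \<Longrightarrow> E x y l
    \<Longrightarrow> matched E (insert x (insert y A)) (add_mset l M)"

lemma matched_pair: "E x y l \<Longrightarrow> x \<noteq> y \<Longrightarrow> matched E {x, y} {#l#}"
  using matched.add[OF matched.empty, of x y E l] by simp

lemma matched_finite: "matched E A M \<Longrightarrow> finite A"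
  by (induction rule: matched.induct) auto

lemma matched_card: "matched E A M \<Longrightarrow> card A = 2 * size M"
  by (induction rule: matched.induct) (auto dest: matched_finite)

lemma matched_Un:
  assumes "matched E A M" "matched E B N" "A \<inter> B = {}"
  shows "matched E (A \<union> B) (M + N)"
  using assms
proof (induction rule: matched.induct)
  case empty
  then show ?case by simp
next
  case (add A M x y l)
  then have "matched E (A \<union> B) (M + N)" "x \<notin> A \<union> B" "y \<notin> A \<union> B" by auto
  from matched.add[OF this add(4,5)] show ?case by simp
qed

lemma matched_image:
  assumes "matched E A M" "inj_on f A"
    and "\<And>x y l. x \<in> A \<Longrightarrow> y \<in> A \<Longrightarrow> x \<noteq> y \<Longrightarrow> l \<in># M \<Longrightarrow> E x y l \<Longrightarrow> E' (f x) (f y) (g l)"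
  shows "matched E' (f ` A) (image_mset g M)"
  using assms
proof (induction rule: matched.induct)
  case empty
  then show ?case by (simp add: matched.empty)
next
  case (add A M x y l)
  have "matched E' (f ` A) (image_mset g M)"
    by (rule add.IH) (use add.prems in \<open>auto simp: inj_on_insert\<close>)
  moreover have "f x \<notin> f ` A" "f y \<notin> f ` A" "f x \<noteq> f y"
    using add.prems(1) add.hyps by (auto simp: inj_on_def)
  moreover have "E' (f x) (f y) (g l)"
    using add.prems(2) add.hyps by auto
  ultimately show ?case by (simp add: matched.add)
qed

section \<open>From labelled matchings of residues to near 1-factors\<close>

definition cyclic_edge :: "nat \<Rightarrow> nat \<Rightarrow> nat \<Rightarrow> nat \<Rightarrow> bool" where
  "cyclic_edge v x y l \<longleftrightarrow> x < v \<and> y < v \<and> x \<noteq> y \<and> edge_length v {x, y} = l"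

text \<open>Since \<open>2 * l < v\<close>, \<open>l\<close> is the shorter of the two arcs, so a
  difference congruent to \<open>l\<close> up to sign must have length \<open>l\<close>.\<close>

lemma edge_length_cong:
  assumes "x < v" "y < v" "2 * l < v"
    and "[int x - int y = int l] (mod int v) \<or> [int y - int x = int l] (mod int v)"
  shows "edge_length v {x, y} = l"
proof -
  have key: "edge_length v {x, y} = l"
    if xy: "x < v" "y < v" and c: "[int x - int y = int l] (mod int v)" for x y
  proof -
    from c obtain k where k: "int x - int y - int l = int v * k"
      by (auto simp: cong_iff_dvd_diff dvd_def)
    \<comment> \<open>The difference lies strictly between \<open>- v\<close> and \<open>v\<close>,
      which leaves only \<open>l\<close> and \<open>l - v\<close>.\<close>
    have "int v * k < int v * 1" "int v * k > int v * (-2)"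
      using xy assms(3) k by linarith+
    then have "k < 1" "k > -2"
      using mult_less_cancel_left_pos[of "int v"] xy by fastforce+
    then have "k = 0 \<or> k = -1" by linarith
    with k xy assms(3) show ?thesis
      using edge_length_pair[OF xy] by (auto simp: min_def split: if_splits)
  qed
  show ?thesis using assms key[of x y] key[of y x] by (auto simp: insert_commute)
qed

lemma matched_edge_set:
  assumes "matched (cyclic_edge v) A M"
  shows "\<exists>F. finite F \<and> F \<subseteq> complete_edges v \<and> \<Union>F = A \<and> length_list v F = M \<and>
    (\<forall>e \<in> F. \<forall>e' \<in> F. e \<noteq> e' \<longrightarrow> e \<inter> e' = {})"
  using assms
proof (induction rule: matched.induct)
  case empty
  show ?case by (intro exI[of _ "{}"]) (auto simp: length_list_def)
next
  case (add A M x y l)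
  then obtain F where F: "finite F" "F \<subseteq> complete_edges v" "\<Union>F = A" "length_list v F = M"
    "\<forall>e \<in> F. \<forall>e' \<in> F. e \<noteq> e' \<longrightarrow> e \<inter> e' = {}" by blast
  have "{x, y} \<notin> F" using F(3) add.hyps by auto
  then have "length_list v (insert {x, y} F) = add_mset l M"
    using F(1,4) add.hyps by (simp add: length_list_def cyclic_edge_def)
  moreover have "{x, y} \<in> complete_edges v"
    using add.hyps by (auto simp: complete_edges_def cyclic_edge_def)
  moreover have "{x, y} \<inter> e = {}" if "e \<in> F" for e using that F(3) add.hyps by auto
  ultimately show ?case
    using F by (intro exI[of _ "insert {x, y} F"]) (auto simp: Int_commute)
qed

lemma matched_imp_near_1_factor:
  assumes "matched (cyclic_edge (2 * n + 1)) ({..<2 * n + 1} - {w}) L" "w < 2 * n + 1"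
  shows "\<exists>F. near_1_factor n F \<and> length_list (2 * n + 1) F = L"
proof -
  from matched_edge_set[OF assms(1)] obtain F where F: "finite F"
    "F \<subseteq> complete_edges (2 * n + 1)" "\<Union>F = {..<2 * n + 1} - {w}" "length_list (2 * n + 1) F = L"
    "\<forall>e \<in> F. \<forall>e' \<in> F. e \<noteq> e' \<longrightarrow> e \<inter> e' = {}" by blast
  have "size L = card F" using F(1,4) by (auto simp: length_list_def)
  moreover have "2 * size L = 2 * n" using matched_card[OF assms(1)] assms(2) by simp
  ultimately have "card F = n" by simp
  with F assms(2) have "near_1_factor n F" unfolding near_1_factor_def F(3) by auto
  with F(4) show ?thesis by blast
qed

text \<open>Bridge from the models to the complete graph: an injection of an odd model into the
  residues is onto by counting, so the omitted point \<open>w\<close> becomes the isolated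
  vertex.\<close>

lemma matched_embed_near_1_factor:
  assumes M: "matched E (A - {w}) M" and w: "w \<in> A" and A: "finite A" "card A = 2 * n + 1"
    and f: "inj_on f A" "\<And>x. x \<in> A \<Longrightarrow> f x < 2 * n + 1"
    and E: "\<And>x y l. x \<in> A \<Longrightarrow> y \<in> A \<Longrightarrow> l \<in># M \<Longrightarrow> E x y l \<Longrightarrow> g l \<le> n \<and>
      ([int (f x) - int (f y) = int (g l)] (mod int (2 * n + 1)) \<or>
       [int (f y) - int (f x) = int (g l)] (mod int (2 * n + 1)))"
  shows "\<exists>F. near_1_factor n F \<and> length_list (2 * n + 1) F = image_mset g M"
proof -
  have "matched (cyclic_edge (2 * n + 1)) (f ` (A - {w})) (image_mset g M)"
  proof (rule matched_image[OF M])
    show "inj_on f (A - {w})" using f(1) by (rule inj_on_subset) auto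
    fix x y l assume *: "x \<in> A - {w}" "y \<in> A - {w}" "x \<noteq> y" "l \<in># M" "E x y l"
    then have "f x \<noteq> f y" using f(1) by (auto simp: inj_on_def)
    moreover have "edge_length (2 * n + 1) {f x, f y} = g l"
      using E[of x y l] * f(2) by (intro edge_length_cong) auto
    ultimately show "cyclic_edge (2 * n + 1) (f x) (f y) (g l)"
      using * f(2) by (auto simp: cyclic_edge_def)
  qed
  moreover have "f ` A = {..<2 * n + 1}"
    using f A by (intro card_subset_eq) (auto simp: card_image)
  then have "f ` (A - {w}) = {..<2 * n + 1} - {f w}"
    using inj_on_image_set_diff[OF f(1), of A "{w}"] w by auto
  ultimately show ?thesis using matched_imp_near_1_factor f(2)[OF w] by metis
qed

section \<open>Necessity of the divisor condition\<close>

lemma near_1_factor_divisor_bound: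
  assumes F: "near_1_factor n F" and d: "d dvd 2 * n + 1"
  shows "2 * size {#x \<in># length_list (2 * n + 1) F. d dvd x#} + d \<le> 2 * n + 1"
proof -
  let ?v = "2 * n + 1"
  define G where "G = {e \<in> F. d dvd edge_length ?v e}"
  have "finite (complete_edges ?v)"
    by (rule finite_subset[of _ "Pow {..<?v}"]) (auto simp: complete_edges_def)
  then have finF: "finite F" using F finite_subset by (auto simp: near_1_factor_def)
  have finG: "finite G" using finF by (simp add: G_def)
  have disj: "e \<inter> e' = {}" if "e \<in> G" "e' \<in> G" "e \<noteq> e'" for e e'
    using F that unfolding near_1_factor_def G_def by auto
  have "{#x \<in># length_list ?v F. d dvd x#} = image_mset (edge_length ?v) (mset_set G)"
    unfolding length_list_def G_def filter_mset_image_mset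
    by (simp add: finF filter_mset_mset_set)
  then have size: "size {#x \<in># length_list ?v F. d dvd x#} = card G" by simp
  obtain m where m: "?v = d * m" using d by (auto simp: dvd_def)
  have dpos: "d > 0" "odd m"
    using m by (auto intro!: gr0I) (metis dvd_triv_left even_Suc even_mult_iff)
  have same: "\<exists>x y. e = {x, y} \<and> x \<noteq> y \<and> x < ?v \<and> y < ?v \<and> x mod d = y mod d" if "e \<in> G" for e
  proof -
    have "F \<subseteq> complete_edges ?v" using F by (simp add: near_1_factor_def)
    then have "e \<in> complete_edges ?v" using that by (auto simp: G_def)
    then obtain x y where xy: "e = {x, y}" "x < ?v" "y < ?v" "x \<noteq> y"
      unfolding complete_edges_def by blast
    have "int d dvd int (edge_length ?v {x, y})" using that xy by (simp add: G_def)
    moreover have "int d dvd int ?v" using d by (simp only: int_dvd_int_iff)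
    \<comment> \<open>The vertex difference is the length or \<open>v\<close> minus the length;
      since \<open>d\<close> divides \<open>v\<close>, it divides the difference in both
      cases.\<close>
    moreover have "int (edge_length ?v {x, y}) = \<bar>int x - int y\<bar> \<or>
        \<bar>int x - int y\<bar> = int ?v - int (edge_length ?v {x, y})"
      unfolding edge_length_pair[OF xy(2,3)] by linarith
    ultimately have "int d dvd \<bar>int x - int y\<bar>" by (metis dvd_diff)
    then have "int d dvd int x - int y" by simp
    then have "int x mod int d = int y mod int d"
      by (simp add: mod_eq_dvd_iff)
    then have "x mod d = y mod d" by (metis of_nat_eq_iff zmod_int)
    with xy show ?thesis by blast
  qed
  define C where "C r = {e \<in> G. \<forall>x \<in> e. x mod d = r}" for r
  have bound: "2 * card (C r) + 1 \<le> m" if r: "r < d" for r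
  proof -
    have CG: "C r \<subseteq> G" by (auto simp: C_def)
    have two: "finite e \<and> card e = 2" if "e \<in> G" for e using same[OF that] by auto
    have "card (\<Union>(C r)) = (\<Sum>e\<in>C r. card e)"
      using CG disj two by (intro card_Union_disjoint) (auto simp: pairwise_def disjnt_def subset_iff)
    also have "\<dots> = (\<Sum>e\<in>C r. 2)"
      using CG two by (intro sum.cong) auto
    finally have "card (\<Union>(C r)) = 2 * card (C r)" by simp
    moreover have "\<Union>(C r) \<subseteq> (\<lambda>i. i * d + r) ` {..<m}"
    proof
      fix x assume "x \<in> \<Union>(C r)"
      then obtain e where e: "e \<in> G" "x \<in> e" "x mod d = r" by (auto simp: C_def)
      from same[OF e(1)] e(2) m have x: "x < d * m" "x mod d = r" using e(3) by auto
      then have "x = (x div d) * d + r" "x div d < m"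
        by (auto simp: less_mult_imp_div_less mult.commute)
      then show "x \<in> (\<lambda>i. i * d + r) ` {..<m}" by blast
    qed
    then have "card (\<Union>(C r)) \<le> m"
      by (metis card_image_le card_lessThan card_mono finite_imageI finite_lessThan le_trans)
    ultimately show ?thesis using dpos(2) by presburger
  qed
  have "e \<in> (\<Union>r<d. C r)" if e: "e \<in> G" for e
  proof -
    from same[OF e] obtain x y where "e = {x, y}" "x mod d = y mod d" by blast
    with e have "e \<in> C (x mod d)" by (auto simp: C_def)
    then show ?thesis using dpos(1) by (intro UN_I[of "x mod d"]) auto
  qed
  then have "G = (\<Union>r<d. C r)" by (auto simp: C_def)
  then have "card G \<le> (\<Sum>r<d. card (C r))" by (simp add: card_UN_le)
  then have "2 * card G + d \<le> (\<Sum>r<d. 2 * card (C r) + 1)"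
    by (simp only: sum.distrib sum_distrib_left[symmetric]) simp
  also have "\<dots> \<le> (\<Sum>r<d. m)" using bound by (intro sum_mono) auto
  finally show ?thesis using size m by simp
qed

section \<open>Matchings of intervals\<close>

lemma matched_subst: "matched E A M \<Longrightarrow> A = B \<Longrightarrow> M = N \<Longrightarrow> matched E B N"
  by simp

definition gap :: "nat \<Rightarrow> nat \<Rightarrow> nat \<Rightarrow> bool" where
  "gap x y l \<longleftrightarrow> y = x + l \<or> x = y + l"

lemma gap_shift:
  assumes "matched gap A M"
  shows "matched gap ((+) p ` A) M"
proof -
  have "matched gap ((+) p ` A) (image_mset (\<lambda>l. l) M)"
    by (rule matched_image[OF assms]) (auto simp: gap_def)
  then show ?thesis by simp
qed

lemma gap_translates:
  assumes "k \<le> t"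
  shows "matched gap ({p..<p + k} \<union> {p + t..<p + t + k}) (replicate_mset k t)"
  using assms
proof (induction k)
  case 0
  then show ?case by (simp add: matched.empty)
next
  case (Suc k)
  have "gap (p + k) (p + t + k) t" by (simp add: gap_def)
  then have "matched gap (insert (p + k) (insert (p + t + k) ({p..<p + k} \<union> {p + t..<p + t + k})))
    (add_mset t (replicate_mset k t))"
    by (intro matched.add) (use Suc in auto)
  then show ?case by (rule matched_subst) auto
qed

text \<open>With \<open>k = t\<close> the two runs of \<open>gap_translates\<close> abut and fill
  \<open>2 * t\<close> consecutive cells, so such blocks can be repeated.\<close>

lemma gap_translate_blocks: "matched gap {p..<p + 2 * t * q} (replicate_mset (t * q) t)"
proof (induction q)
  case 0
  then show ?case by (simp add: matched.empty)
next
  case (Suc q)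
  have "matched gap ({p..<p + 2 * t * q} \<union>
      ({p + 2 * t * q..<p + 2 * t * q + t} \<union> {p + 2 * t * q + t..<p + 2 * t * q + t + t}))
      (replicate_mset (t * q) t + replicate_mset t t)"
    by (rule matched_Un[OF Suc gap_translates]) auto
  then show ?case
    by (rule matched_subst) (auto simp: replicate_mset_eq_iff algebra_simps multiset_eq_iff)
qed

text \<open>Two interleaved 2-edges fill four consecutive cells, which is why \<open>b\<close> is
  taken even; 1-edges fill the rest.\<close>

lemma gap_even_interval:
  assumes "even b" "b \<le> k"
  shows "matched gap {p..<p + 2 * k} (replicate_mset (k - b) 1 + replicate_mset b 2)"
proof -
  from assms(1) obtain j where j: "b = 2 * j" by (auto elim: evenE)
  have "matched gap ({p + 4 * j..<p + 4 * j + 2 * 1 * (k - b)} \<union> {p..<p + 2 * 2 * j})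
      (replicate_mset (1 * (k - b)) 1 + replicate_mset (2 * j) 2)"
    by (rule matched_Un[OF gap_translate_blocks gap_translate_blocks]) auto
  then show ?thesis by (rule matched_subst) (use assms j in auto)
qed

text \<open>For odd \<open>b\<close> one 2-edge jumps over the hole at \<open>p + 1\<close>, which
  removes the parity restriction; for even \<open>b\<close> the hole sits at the end.\<close>

lemma gap_odd_interval:
  assumes "b \<le> k"
  shows "\<exists>w\<in>{p..<p + 2 * k + 1}. matched gap ({p..<p + 2 * k + 1} - {w})
    (replicate_mset (k - b) 1 + replicate_mset b 2)"
proof (cases "even b")
  case True
  have "matched gap ({p..<p + 2 * k + 1} - {p + 2 * k})
      (replicate_mset (k - b) 1 + replicate_mset b 2)"
    by (rule matched_subst[OF gap_even_interval[OF True assms, of p]]) auto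
  then show ?thesis by (intro bexI[of _ "p + 2 * k"]) auto
next
  case False
  then have b: "b \<ge> 1" "even (b - 1)" "b - 1 \<le> k - 1" using assms by (auto elim: oddE)
  have "matched gap ({p, p + 2} \<union> {p + 3..<p + 3 + 2 * (k - 1)})
      ({#2#} + (replicate_mset (k - 1 - (b - 1)) 1 + replicate_mset (b - 1) 2))"
    by (rule matched_Un[OF matched_pair gap_even_interval[OF b(2,3)]]) (auto simp: gap_def)
  then have "matched gap ({p..<p + 2 * k + 1} - {p + 1})
      (replicate_mset (k - b) 1 + replicate_mset b 2)"
    by (rule matched_subst) (use b assms in \<open>auto simp: multiset_eq_iff\<close>)
  then show ?thesis using assms b by (intro bexI[of _ "p + 1"]) auto
qed

text \<open>Distribution of the 2-edges over an odd interval with \<open>k1\<close> edges and an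
  even one with \<open>k2\<close>, whose share must be even. The assumptions exclude the
  obstructions: a full load \<open>b = k1 + k2\<close> with \<open>k2\<close> odd, and odd
  \<open>b\<close> with \<open>k1 = 0\<close>.\<close>

lemma odd_even_interval_split:
  fixes b k1 k2 :: nat
  assumes "b < k1 + k2 \<or> b = 0" "\<not> (odd b \<and> k1 = 0)"
  shows "\<exists>b1 b2. b = b1 + b2 \<and> b1 \<le> k1 \<and> b2 \<le> k2 \<and> even b2"
proof (cases "b \<le> k2")
  case True
  show ?thesis
  proof (cases "even b")
    case True
    with \<open>b \<le> k2\<close> show ?thesis by (intro exI[of _ 0] exI[of _ b]) simp
  next
    case False
    with \<open>b \<le> k2\<close> assms show ?thesis by (intro exI[of _ 1] exI[of _ "b - 1"]) (auto elim: oddE)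
  qed
next
  case False
  show ?thesis
  proof (cases "even k2")
    case True
    with False assms show ?thesis by (intro exI[of _ "b - k2"] exI[of _ k2]) auto
  next
    case odd: False
    with False assms show ?thesis
      by (intro exI[of _ "b - (k2 - 1)"] exI[of _ "k2 - 1"]) (auto elim: oddE)
  qed
qed

lemma gap_two_intervals:
  assumes "a + b = k1 + k2" "a \<ge> 1 \<or> b = 0" "\<not> (odd b \<and> k1 = 0)"
    and "{p..<p + 2 * k1 + 1} \<inter> {q..<q + 2 * k2} = {}"
  shows "\<exists>w\<in>{p..<p + 2 * k1 + 1}. matched gap
    ({p..<p + 2 * k1 + 1} \<union> {q..<q + 2 * k2} - {w}) (replicate_mset a 1 + replicate_mset b 2)"
proof -
  from odd_even_interval_split[of b k1 k2] assms obtain b1 b2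
    where b: "b = b1 + b2" "b1 \<le> k1" "b2 \<le> k2" "even b2" by fastforce
  from gap_odd_interval[OF b(2), of p] obtain w where w: "w \<in> {p..<p + 2 * k1 + 1}"
    "matched gap ({p..<p + 2 * k1 + 1} - {w}) (replicate_mset (k1 - b1) 1 + replicate_mset b1 2)"
    by blast
  have "matched gap (({p..<p + 2 * k1 + 1} - {w}) \<union> {q..<q + 2 * k2})
    ((replicate_mset (k1 - b1) 1 + replicate_mset b1 2) +
     (replicate_mset (k2 - b2) 1 + replicate_mset b2 2))"
    by (rule matched_Un[OF w(2) gap_even_interval[OF b(4,3)]]) (use assms(4) in auto)
  then have "matched gap ({p..<p + 2 * k1 + 1} \<union> {q..<q + 2 * k2} - {w})
      (replicate_mset a 1 + replicate_mset b 2)"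
    by (rule matched_subst) (use w(1) assms(1,4) b in \<open>auto simp: multiset_eq_iff\<close>)
  with w(1) show ?thesis by blast
qed

text \<open>The \<open>t\<close>-edges join the first \<open>k\<close> cells to their translates,
  which leaves \<open>{k..<t}\<close> and \<open>{t + k..<s}\<close>. Their total size is odd, so
  exactly one of them is odd, and \<open>gap_two_intervals\<close> fills both except in a degenerate
  case.\<close>

lemma gap_short:
  assumes k: "1 \<le> k" "k < t" and ab: "a \<ge> 1 \<or> b = 0" and s: "s = 2 * (a + b + k) + 1" "t + k \<le> s"
  shows "\<exists>w<s. matched gap ({..<s} - {w})
    (replicate_mset a 1 + replicate_mset b 2 + replicate_mset k t)"
proof -
  have two: ?thesis
    if eq: "{k..<t} \<union> {t + k..<s} = {p..<p + 2 * k1 + 1} \<union> {q..<q + 2 * k2}"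
      and disj: "{p..<p + 2 * k1 + 1} \<inter> {q..<q + 2 * k2} = {}"
      and k12: "k1 + k2 = a + b" "\<not> (odd b \<and> k1 = 0)" for p q k1 k2
  proof -
    from gap_two_intervals[OF k12(1)[symmetric] ab k12(2) disj] obtain w
      where w: "w \<in> {p..<p + 2 * k1 + 1}" "matched gap ({k..<t} \<union> {t + k..<s} - {w})
        (replicate_mset a 1 + replicate_mset b 2)"
      unfolding eq by blast
    from w(1) eq have w': "w \<in> {k..<t} \<union> {t + k..<s}" by blast
    have "matched gap (({k..<t} \<union> {t + k..<s} - {w}) \<union> ({0..<0 + k} \<union> {0 + t..<0 + t + k}))
       ((replicate_mset a 1 + replicate_mset b 2) + replicate_mset k t)"
      by (rule matched_Un[OF w(2) gap_translates]) (use k in auto)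
    then have "matched gap ({..<s} - {w})
        (replicate_mset a 1 + replicate_mset b 2 + replicate_mset k t)"
      by (rule matched_subst) (use w' k s(2) in auto)
    moreover have "w < s" using w' s(2) by auto
    ultimately show ?thesis by blast
  qed
  show ?thesis
  proof (cases "odd (t - k)")
    case True
    then obtain k1 where "t - k = 2 * k1 + 1" by (rule oddE)
    then have k1: "t = k + 2 * k1 + 1" using k by simp
    define k2 where "k2 = a + b - k1"
    have k2: "s = t + k + 2 * k2" "k1 + k2 = a + b" using s k1 by (auto simp: k2_def)
    \<comment> \<open>A one-point odd interval cannot absorb an odd number of 2-edges; one \<open>t\<close>-edge is then moved
      so that its cells and the point admit a 2-edge.\<close>
    show ?thesis
    proof (cases "odd b \<and> k1 = 0")
      case False
      show ?thesis by (rule two[of k k1 "t + k" k2]) (use False k1 k2 in auto)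
    next
      case True
      then have t: "t = k + 1" and b: "even (b - 1)" "b - 1 \<le> k2 - 1" "b \<ge> 1" "k2 = a + b" "a \<ge> 1"
        using k1 k2 ab by (auto elim: oddE)
      have "matched gap (({0..<0 + (k - 1)} \<union> {0 + t..<0 + t + (k - 1)}) \<union>
          ({k, t + k} \<union> ({2 * k, 2 * k + 2} \<union> {2 * k + 3..<2 * k + 3 + 2 * (k2 - 1)})))
          (replicate_mset (k - 1) t + ({#t#} + ({#2#} +
            (replicate_mset (k2 - 1 - (b - 1)) 1 + replicate_mset (b - 1) 2))))"
        by (intro matched_Un gap_translates gap_even_interval matched_pair)
           (use t k b in \<open>auto simp: gap_def\<close>)
      then have "matched gap ({..<s} - {k - 1})
          (replicate_mset a 1 + replicate_mset b 2 + replicate_mset k t)"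
      proof (rule matched_subst)
        have "s = 2 * k + 1 + 2 * k2" using k2 t by simp
        then show "{0..<0 + (k - 1)} \<union> {0 + t..<0 + t + (k - 1)} \<union>
            ({k, t + k} \<union> ({2 * k, 2 * k + 2} \<union> {2 * k + 3..<2 * k + 3 + 2 * (k2 - 1)})) =
            {..<s} - {k - 1}"
          unfolding t using k(1) b(3-5) by auto
        have "replicate_mset k t = add_mset t (replicate_mset (k - 1) t)" using k by (cases k) auto
        moreover have "replicate_mset b 2 = add_mset (2 :: nat) (replicate_mset (b - 1) 2)"
          using b(3) by (cases b) auto
        moreover have "k2 - 1 - (b - 1) = a" using b by simp
        ultimately show "replicate_mset (k - 1) t + ({#t#} + ({#2#} +
            (replicate_mset (k2 - 1 - (b - 1)) 1 + replicate_mset (b - 1) 2))) =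
            replicate_mset a 1 + replicate_mset b 2 + replicate_mset k t" by simp
      qed
      then show ?thesis using k s(2) by (intro exI[of _ "k - 1"]) auto
    qed
  next
    case False
    then have "even (t - k)" by simp
    then obtain k2 where "t - k = 2 * k2" by (rule evenE)
    then have k2: "t = k + 2 * k2" using k by simp
    define k1 where "k1 = a + b - k2"
    have k1: "s = t + k + 2 * k1 + 1" "k1 + k2 = a + b" using s k2 by (auto simp: k1_def)
    show ?thesis
    proof (cases "odd b \<and> k1 = 0")
      case False
      show ?thesis by (rule two[of "t + k" k1 k k2]) (use False k1 k2 in auto)
    next
      case True
      then have b: "even (b - 1)" "b - 1 \<le> k2 - 1" "b \<ge> 1" "k2 = a + b" "a \<ge> 1"
        using k1 k2 ab by (auto elim: oddE)
      \<comment> \<open>Here the odd interval is the single cell \<open>t + k\<close>. The last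
        \<open>t\<close>-edge moves one step to the right, the freed cell \<open>k - 1\<close> is
        joined to \<open>k + 1\<close> by a 2-edge, and \<open>t + k - 1\<close> becomes the
        hole.\<close>
      have "matched gap (({0..<0 + (k - 1)} \<union> {0 + t..<0 + t + (k - 1)}) \<union>
          ({k, t + k} \<union> ({k - 1, k + 1} \<union> {k + 2..<k + 2 + 2 * (k2 - 1)})))
          (replicate_mset (k - 1) t + ({#t#} + ({#2#} +
            (replicate_mset (k2 - 1 - (b - 1)) 1 + replicate_mset (b - 1) 2))))"
        by (intro matched_Un gap_translates gap_even_interval matched_pair)
           (use k2 k b in \<open>auto simp: gap_def\<close>)
      then have "matched gap ({..<s} - {t + k - 1})
          (replicate_mset a 1 + replicate_mset b 2 + replicate_mset k t)"
      proof (rule matched_subst)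
        have st: "s = t + k + 1" "t = k + 2 * k2" and "k2 \<ge> 1" using k1 k2 True b by auto
        show "{0..<0 + (k - 1)} \<union> {0 + t..<0 + t + (k - 1)} \<union>
            ({k, t + k} \<union> ({k - 1, k + 1} \<union> {k + 2..<k + 2 + 2 * (k2 - 1)})) =
            {..<s} - {t + k - 1}"
          using \<open>k2 \<ge> 1\<close> k(1) unfolding st by auto
        have "replicate_mset k t = add_mset t (replicate_mset (k - 1) t)" using k by (cases k) auto
        moreover have "replicate_mset b 2 = add_mset (2 :: nat) (replicate_mset (b - 1) 2)"
          using b(3) by (cases b) auto
        moreover have "k2 - 1 - (b - 1) = a" using b by simp
        ultimately show "replicate_mset (k - 1) t + ({#t#} + ({#2#} +
            (replicate_mset (k2 - 1 - (b - 1)) 1 + replicate_mset (b - 1) 2))) =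
            replicate_mset a 1 + replicate_mset b 2 + replicate_mset k t" by simp
      qed
      then show ?thesis using k s(2) by (intro exI[of _ "t + k - 1"]) auto
    qed
  qed
qed

text \<open>Full blocks come first, and the remaining \<open>c mod t\<close> edges of length
  \<open>t\<close> go to \<open>gap_short\<close>; the condition on \<open>c mod t\<close> says that
  their translates fit into the remaining cells.\<close>

lemma gap_path:
  assumes ab: "a \<ge> 1 \<or> b = 0" and s: "s = 2 * (a + b + c) + 1"
    and t: "c mod t = 0 \<or> t \<le> 2 * (a + b) + 1 + c mod t" "t \<ge> 1"
  shows "\<exists>w<s. matched gap ({..<s} - {w})
    (replicate_mset a 1 + replicate_mset b 2 + replicate_mset c t)"
proof -
  define k q s' where kqs: "k = c mod t" "q = c div t" "s' = 2 * (a + b + k) + 1"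
  have "\<exists>w<s'. matched gap ({..<s'} - {w})
    (replicate_mset a 1 + replicate_mset b 2 + replicate_mset k t)"
  proof (cases "k = 0")
    case True
    from gap_odd_interval[of b "a + b" 0] True show ?thesis
      by (auto simp: kqs atLeast0LessThan)
  next
    case False
    then show ?thesis using t ab by (intro gap_short) (auto simp: kqs)
  qed
  then obtain w where w: "w < s'" "matched gap ({..<s'} - {w})
    (replicate_mset a 1 + replicate_mset b 2 + replicate_mset k t)" by blast
  have c: "c = t * q + k" by (simp add: kqs)
  have s'': "s = 2 * t * q + s'" using c by (simp add: s kqs(3) algebra_simps)
  have "(+) p ` ({..<s'} - {w}) = {p..<p + s'} - {p + w}" for p
  proof (intro set_eqI iffI)
    fix x assume "x \<in> {p..<p + s'} - {p + w}"
    then have "x - p \<in> {..<s'} - {w}" "x = p + (x - p)" by auto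
    then show "x \<in> (+) p ` ({..<s'} - {w})" by (rule image_eqI[rotated])
  qed auto
  then have "(+) (2 * t * q) ` ({..<s'} - {w}) = {2 * t * q..<s} - {2 * t * q + w}"
    by (simp only: s'')
  then have "matched gap ({2 * t * q..<s} - {2 * t * q + w})
      (replicate_mset a 1 + replicate_mset b 2 + replicate_mset k t)"
    using gap_shift[OF w(2), of "2 * t * q"] by simp
  then have "matched gap (({2 * t * q..<s} - {2 * t * q + w}) \<union> {0..<0 + 2 * t * q})
      ((replicate_mset a 1 + replicate_mset b 2 + replicate_mset k t) + replicate_mset (t * q) t)"
    by (rule matched_Un[OF _ gap_translate_blocks]) auto
  then have "matched gap ({..<s} - {2 * t * q + w})
      (replicate_mset a 1 + replicate_mset b 2 + replicate_mset c t)"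
    by (rule matched_subst) (use s'' c in \<open>auto simp: multiset_eq_iff\<close>)
  moreover have "2 * t * q + w < s" using s'' w by simp
  ultimately show ?thesis by blast
qed

section \<open>Matchings of grids\<close>

text \<open>
  The cell \<open>(j, i)\<close>, row \<open>j\<close> and column \<open>i\<close>, will be placed at the residue
  \<open>j * y + i * x\<close>. Label 0 marks a horizontal edge, and a positive label is the height of a
  vertical one; labels 0, 1, 2 turn into the lengths \<open>x\<close>, \<open>y\<close>, \<open>2 * y\<close>.
\<close>

definition grid :: "nat \<times> nat \<Rightarrow> nat \<times> nat \<Rightarrow> nat \<Rightarrow> bool" where
  "grid p q l \<longleftrightarrow> (if l = 0 then fst p = fst q \<and> gap (snd p) (snd q) 1
    else snd p = snd q \<and> gap (fst p) (fst q) l)"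

lemma grid_column:
  assumes "matched gap R M" "0 \<notin># M"
  shows "matched grid (R \<times> {i}) M"
proof -
  have "matched grid ((\<lambda>j. (j, i)) ` R) (image_mset (\<lambda>l. l) M)"
    by (rule matched_image[OF assms(1)]) (use assms(2) in \<open>auto simp: grid_def inj_on_def intro: gr0I\<close>)
  moreover have "(\<lambda>j. (j, i)) ` R = R \<times> {i}" by auto
  ultimately show ?thesis by simp
qed

lemma grid_rows:
  assumes "finite C"
  shows "matched grid (C \<times> {i, Suc i}) (replicate_mset (card C) 0)"
  using assms
proof (induction rule: finite_induct)
  case empty
  then show ?case by (simp add: matched.empty)
next
  case (insert j C)
  have "matched grid ({(j, i), (j, Suc i)} \<union> C \<times> {i, Suc i}) ({#0#} + replicate_mset (card C) 0)"
    by (rule matched_Un[OF matched_pair insert.IH])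
       (use insert.hyps in \<open>auto simp: grid_def gap_def\<close>)
  then show ?case by (rule matched_subst) (use insert.hyps in auto)
qed

text \<open>Both columns receive the same vertical pattern \<open>R\<close>, so the remaining cells
  lie side by side and take horizontal edges. Hence the vertical edges come in equal pairs. The
  number \<open>z\<close> is determined later by counting.\<close>

lemma grid_column_pair:
  assumes "\<alpha> + \<beta> \<le> g"
  shows "\<exists>z. matched grid ({..<2 * g + 1} \<times> {c, Suc c})
    (replicate_mset (2 * \<alpha>) 1 + replicate_mset (2 * \<beta>) 2 + replicate_mset z 0)"
proof -
  from gap_odd_interval[of \<beta> "\<alpha> + \<beta>" 0] obtain w where w: "matched gap ({0..<0 + 2 * (\<alpha> + \<beta>) + 1} - {w})
    (replicate_mset \<alpha> 1 + replicate_mset \<beta> 2)" by auto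
  define R where "R = {0..<0 + 2 * (\<alpha> + \<beta>) + 1} - {w}"
  let ?C = "{..<2 * g + 1} - R"
  have col: "matched grid (R \<times> {i}) (replicate_mset \<alpha> 1 + replicate_mset \<beta> 2)" for i
    by (rule grid_column) (use w in \<open>auto simp: R_def\<close>)
  have "matched grid (R \<times> {c} \<union> (R \<times> {Suc c} \<union> ?C \<times> {c, Suc c}))
    ((replicate_mset \<alpha> 1 + replicate_mset \<beta> 2) +
     ((replicate_mset \<alpha> 1 + replicate_mset \<beta> 2) + replicate_mset (card ?C) 0))"
    by (intro matched_Un col grid_rows) auto
  moreover have "R \<subseteq> {..<2 * g + 1}" using assms by (auto simp: R_def)
  then have "R \<times> {c} \<union> (R \<times> {Suc c} \<union> ?C \<times> {c, Suc c}) = {..<2 * g + 1} \<times> {c, Suc c}"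
    by blast
  moreover have "replicate_mset \<alpha> 1 + replicate_mset \<beta> 2 +
      (replicate_mset \<alpha> 1 + replicate_mset \<beta> 2 + replicate_mset (card ?C) 0) =
      replicate_mset (2 * \<alpha>) 1 + replicate_mset (2 * \<beta>) (2 :: nat) + replicate_mset (card ?C) 0"
    by (simp add: multiset_eq_iff)
  ultimately show ?thesis by metis
qed

lemma grid_column_pairs:
  assumes "\<alpha> + \<beta> \<le> g * k"
  shows "\<exists>z. matched grid ({..<2 * g + 1} \<times> {c..<c + 2 * k})
    (replicate_mset (2 * \<alpha>) 1 + replicate_mset (2 * \<beta>) 2 + replicate_mset z 0)"
  using assms
proof (induction k arbitrary: \<alpha> \<beta>)
  case 0
  then show ?case by (auto intro!: exI[of _ 0] matched.empty)
next
  case (Suc k)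
  \<comment> \<open>Greedy choice: the last column pair takes as many vertical edges as it can, so
    either nothing is left over or \<open>\<alpha>' + \<beta>' = g\<close>.\<close>
  define \<alpha>' \<beta>' where "\<alpha>' = min \<alpha> g" "\<beta>' = min \<beta> (g - \<alpha>')"
  then have *: "\<alpha>' \<le> \<alpha>" "\<beta>' \<le> \<beta>" "\<alpha>' + \<beta>' \<le> g" "(\<alpha> - \<alpha>') + (\<beta> - \<beta>') \<le> g * k"
    using Suc.prems by (auto simp: min_def)
  from Suc.IH[OF *(4)] obtain z1 where z1: "matched grid ({..<2 * g + 1} \<times> {c..<c + 2 * k})
    (replicate_mset (2 * (\<alpha> - \<alpha>')) 1 + replicate_mset (2 * (\<beta> - \<beta>')) 2 + replicate_mset z1 0)"
    by blast
  from grid_column_pair[OF *(3)] obtain z2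
    where z2: "matched grid ({..<2 * g + 1} \<times> {c + 2 * k, Suc (c + 2 * k)})
    (replicate_mset (2 * \<alpha>') 1 + replicate_mset (2 * \<beta>') 2 + replicate_mset z2 0)" by blast
  have "matched grid ({..<2 * g + 1} \<times> {c..<c + 2 * k} \<union> {..<2 * g + 1} \<times> {c + 2 * k, Suc (c + 2 * k)})
    ((replicate_mset (2 * (\<alpha> - \<alpha>')) 1 + replicate_mset (2 * (\<beta> - \<beta>')) 2 + replicate_mset z1 0) +
     (replicate_mset (2 * \<alpha>') 1 + replicate_mset (2 * \<beta>') 2 + replicate_mset z2 0))"
    by (rule matched_Un[OF z1 z2]) auto
  then have "matched grid ({..<2 * g + 1} \<times> {c..<c + 2 * Suc k})
    (replicate_mset (2 * \<alpha>) 1 + replicate_mset (2 * \<beta>) 2 + replicate_mset (z1 + z2) 0)"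
    by (rule matched_subst) (use *(1,2) in \<open>auto simp: multiset_eq_iff\<close>)
  then show ?case by blast
qed

text \<open>Parity correction: three columns absorb \<open>g + 1\<close> vertical edges, one more
  than a single column. One vertical edge sits in column 0 and \<open>g\<close> in column 2; row 0
  is joined across columns 1 and 2, and the rows that miss the edge in column 0 are joined across
  columns 0 and 1.\<close>

lemma grid_three_columns:
  assumes "g \<ge> 1" "a + b = g + 1" "b \<le> g"
  shows "\<exists>w \<in> {..<2 * g + 1} \<times> {0..<3}. \<exists>z. matched grid ({..<2 * g + 1} \<times> {0..<3} - {w})
    (replicate_mset a 1 + replicate_mset b 2 + replicate_mset z 0)"
proof (cases "even b")
  case True
  let ?C = "{2..<2 * g + 1}"
  have "matched grid ({0, 1} \<times> {0} \<union> ({1..<1 + 2 * g} \<times> {2} \<union> ({0} \<times> {1, Suc 1} \<union> ?C \<times> {0, Suc 0})))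
    ({#1#} + ((replicate_mset (g - b) 1 + replicate_mset b 2) +
     (replicate_mset (card {0::nat}) 0 + replicate_mset (card ?C) 0)))"
    by (intro matched_Un grid_column grid_rows gap_even_interval matched_pair)
       (use True assms in \<open>auto simp: gap_def\<close>)
  then have "matched grid ({..<2 * g + 1} \<times> {0..<3} - {(1, 1)})
    (replicate_mset a 1 + replicate_mset b 2 + replicate_mset (1 + card ?C) 0)"
    by (rule matched_subst) (use assms in \<open>auto simp: multiset_eq_iff\<close>)
  then show ?thesis using assms(1) by (intro bexI[of _ "(1, 1)"]) auto
next
  case False
  then have b: "b \<ge> 1" "even (b - 1)" by (auto elim: oddE)
  \<comment> \<open>For odd \<open>b\<close> the edge in column 0 has height 2, so that column 2
    gets the even number \<open>b - 1\<close>.\<close>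
  let ?C = "insert 1 {3..<2 * g + 1}"
  have "matched grid ({0, 2} \<times> {0} \<union> ({1..<1 + 2 * g} \<times> {2} \<union> ({0} \<times> {1, Suc 1} \<union> ?C \<times> {0, Suc 0})))
    ({#2#} + ((replicate_mset (g - (b - 1)) 1 + replicate_mset (b - 1) 2) +
     (replicate_mset (card {0::nat}) 0 + replicate_mset (card ?C) 0)))"
    by (intro matched_Un grid_column grid_rows gap_even_interval matched_pair)
       (use b assms in \<open>auto simp: gap_def\<close>)
  then have "matched grid ({..<2 * g + 1} \<times> {0..<3} - {(2, 1)})
    (replicate_mset a 1 + replicate_mset b 2 + replicate_mset (1 + card ?C) 0)"
  proof (rule matched_subst)
    show "{0, 2} \<times> {0} \<union> ({1..<1 + 2 * g} \<times> {2} \<union> ({0} \<times> {1, Suc 1} \<union> ?C \<times> {0, Suc 0})) =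
        {..<2 * g + 1} \<times> {0..<3} - {(2, 1)}" (is "?A = ?B")
    proof (rule set_eqI)
      fix p :: "nat \<times> nat"
      obtain j i where p: "p = (j, i)" by (cases p)
      consider "i = 0" | "i = 1" | "i = 2" | "i \<ge> 3" by linarith
      then show "p \<in> ?A \<longleftrightarrow> p \<in> ?B"
        using assms(1) by cases (simp_all add: p, linarith+)
    qed
    have "replicate_mset b 2 = add_mset (2 :: nat) (replicate_mset (b - 1) 2)"
      using b(1) by (cases b) auto
    moreover have "g - (b - 1) = a" using assms(2,3) b(1) by simp
    ultimately show "{#2 :: nat#} + (replicate_mset (g - (b - 1)) 1 + replicate_mset (b - 1) 2 +
        (replicate_mset (card {0::nat}) 0 + replicate_mset (card ?C) 0)) =
        replicate_mset a 1 + replicate_mset b 2 + replicate_mset (1 + card ?C) 0" by simp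
  qed
  moreover have "(2, 1) \<in> {..<2 * g + 1} \<times> {0..<3::nat}" using assms(1) by auto
  ultimately show ?thesis by blast
qed

text \<open>Column pairs consume each label an even number of times; \<open>a0\<close> and
  \<open>b0\<close> go to the unpaired columns. The last conjunct supplies the bound
  \<open>b0 \<le> g\<close> that three columns require.\<close>

lemma same_parity_split:
  fixes a b G :: nat
  assumes "G \<ge> 1" "a \<ge> 1" "G \<le> a + b" "even (a + b - G)"
  shows "\<exists>a0 b0 \<alpha> \<beta>. a = a0 + 2 * \<alpha> \<and> b = b0 + 2 * \<beta> \<and> a0 + b0 = G \<and> (G \<ge> 2 \<longrightarrow> b0 < G)"
proof -
  consider "a \<le> G" | "a > G" "even (a - G)" | "a > G" "odd (a - G)" by fastforce
  then show ?thesis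
  proof cases
    case 1
    with assms(4) have "even (b - (G - a))" by (simp add: diff_diff_eq2 add.commute)
    then obtain u where "b - (G - a) = 2 * u" by (rule evenE)
    with 1 assms have "b = G - a + 2 * u" "a + (G - a) = G" "G - a < G" by auto
    then show ?thesis by (metis add.right_neutral mult_0_right)
  next
    case 2
    with assms have "even b" by auto
    then obtain u where u: "b = 2 * u" by (rule evenE)
    from 2 obtain t where "a - G = 2 * t" by (blast elim: evenE)
    with 2 have "a = G + 2 * t" by simp
    with u assms(1) show ?thesis by (intro exI[of _ G] exI[of _ 0] exI[of _ t] exI[of _ u]) auto
  next
    case 3
    with assms have "odd b" by auto
    then obtain u where u: "b = 2 * u + 1" by (rule oddE)
    from 3 obtain t where "a - G = 2 * t + 1" by (blast elim: oddE)
    with 3 assms(1) have "a = G - 1 + 2 * (t + 1)" by simp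
    with u assms(1) show ?thesis
      by (intro exI[of _ "G - 1"] exI[of _ 1] exI[of _ "t + 1"] exI[of _ u]) auto
  qed
qed

text \<open>The parity of \<open>a + b - g\<close> decides between one unpaired column with
  \<open>g\<close> vertical edges and three with \<open>g + 1\<close>. The other
  \<open>m - 1\<close> or \<open>m - 3\<close> columns hold at most \<open>g\<close> each, which
  yields the capacities \<open>g * m\<close> and \<open>g * (m - 2) + 1\<close>.\<close>

lemma grid_near_matching:
  assumes g: "g \<ge> 1" and m: "odd m" "m \<ge> 3" and a: "a \<ge> 1" "g \<le> a + b"
    and ab: "even (a + b - g) \<and> a + b \<le> g * m \<or> a + b \<le> g * (m - 2) + 1"
  shows "\<exists>w \<in> {..<2 * g + 1} \<times> {..<m}. \<exists>z. matched grid ({..<2 * g + 1} \<times> {..<m} - {w})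
    (replicate_mset a 1 + replicate_mset b 2 + replicate_mset z 0)"
proof -
  have *: ?thesis
    if w: "w \<in> {..<2 * g + 1} \<times> {0..<c}" and c: "m = c + 2 * k" and k: "\<alpha> + \<beta> \<le> g * k"
      and ab: "a = a0 + 2 * \<alpha>" "b = b0 + 2 * \<beta>"
      and M: "matched grid ({..<2 * g + 1} \<times> {0..<c} - {w})
        (replicate_mset a0 1 + replicate_mset b0 2 + replicate_mset z0 0)"
    for w c k \<alpha> \<beta> a0 b0 z0
  proof -
    from grid_column_pairs[OF k, of c] obtain z
      where z: "matched grid ({..<2 * g + 1} \<times> {c..<c + 2 * k})
        (replicate_mset (2 * \<alpha>) 1 + replicate_mset (2 * \<beta>) 2 + replicate_mset z 0)" by blast
    have "matched grid (({..<2 * g + 1} \<times> {0..<c} - {w}) \<union> {..<2 * g + 1} \<times> {c..<c + 2 * k})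
        ((replicate_mset a0 1 + replicate_mset b0 2 + replicate_mset z0 0) +
         (replicate_mset (2 * \<alpha>) 1 + replicate_mset (2 * \<beta>) 2 + replicate_mset z 0))"
      by (rule matched_Un[OF M z]) auto
    then have "matched grid ({..<2 * g + 1} \<times> {..<m} - {w})
        (replicate_mset a 1 + replicate_mset b 2 + replicate_mset (z0 + z) 0)"
      by (rule matched_subst) (use w c ab in \<open>auto simp: multiset_eq_iff\<close>)
    moreover have "w \<in> {..<2 * g + 1} \<times> {..<m}" using w c by auto
    ultimately show ?thesis by blast
  qed
  show ?thesis
  proof (cases "even (a + b - g)")
    case True
    from same_parity_split[OF g a True] obtain a0 b0 \<alpha> \<beta>
      where s: "a = a0 + 2 * \<alpha>" "b = b0 + 2 * \<beta>" "a0 + b0 = g" by blast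
    from m(1) obtain k where k: "m = 1 + 2 * k" by (auto elim: oddE)
    from m(2) obtain m' where m': "m = m' + 2" using that[of "m - 2"] by simp
    have "g * m = g * (m - 2) + 2 * g" unfolding m' by (simp add: algebra_simps)
    then have "a + b \<le> g * m" using ab g by linarith
    then have ks: "\<alpha> + \<beta> \<le> g * k" using s k by (simp add: algebra_simps)
    from gap_odd_interval[of b0 g 0] s(3) obtain w where w: "w < 2 * g + 1"
      "matched gap ({..<2 * g + 1} - {w}) (replicate_mset a0 1 + replicate_mset b0 2)"
      unfolding s(3)[symmetric] by (auto simp: atLeast0LessThan)
    have "matched grid (({..<2 * g + 1} - {w}) \<times> {0}) (replicate_mset a0 1 + replicate_mset b0 2)"
      by (rule grid_column[OF w(2)]) auto
    then have "matched grid ({..<2 * g + 1} \<times> {0..<1} - {(w, 0)})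
        (replicate_mset a0 1 + replicate_mset b0 2 + replicate_mset 0 0)"
      by (rule matched_subst) auto
    then show ?thesis by (rule *[OF _ k ks s(1,2), rotated]) (use w(1) in auto)
  next
    case False
    then have a': "g + 1 \<le> a + b" "even (a + b - (g + 1))" using a(2)
      by (cases "a + b = g"; simp)+
    from same_parity_split[OF _ a(1) a'] g obtain a0 b0 \<alpha> \<beta>
      where s: "a = a0 + 2 * \<alpha>" "b = b0 + 2 * \<beta>" "a0 + b0 = g + 1" "b0 \<le> g" by fastforce
    have "even (m - 3)" using m by simp
    then obtain k where "m - 3 = 2 * k" by (rule evenE)
    then have k: "m = 3 + 2 * k" using m(2) by simp
    have "a + b \<le> g * (m - 2) + 1" using ab False by blast
    then have ks: "\<alpha> + \<beta> \<le> g * k" using s k by (simp add: algebra_simps)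
    from grid_three_columns[OF g s(3,4)] obtain w z where
      "w \<in> {..<2 * g + 1} \<times> {0..<3}" "matched grid ({..<2 * g + 1} \<times> {0..<3} - {w})
        (replicate_mset a0 1 + replicate_mset b0 2 + replicate_mset z 0)" by blast
    then show ?thesis by (intro *[OF _ k ks s(1,2)])
  qed
qed

section \<open>Realizable lists of lengths\<close>

definition realizable :: "nat \<Rightarrow> nat multiset \<Rightarrow> bool" where
  "realizable n L \<longleftrightarrow> (\<exists>F. near_1_factor n F \<and> length_list (2 * n + 1) F = L)"

text \<open>The path is the natural order of the vertices. A nonzero \<open>c mod t\<close>
  contributes at least 1, which turns the bound on \<open>(t - 1) div 2\<close> into the fitting
  condition of \<open>gap_path\<close>.\<close>

lemma realizable_one_two:
  assumes "a \<ge> 1 \<or> b = 0" "a + b + c = n" "1 \<le> t" "t \<le> n" "2 \<le> n" "(t - 1) div 2 \<le> a + b"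
  shows "realizable n (replicate_mset a 1 + replicate_mset b 2 + replicate_mset c t)"
proof -
  have "c mod t = 0 \<or> t \<le> 2 * (a + b) + 1 + c mod t" 
  proof (cases "c mod t = 0")
    case False
    then have "c mod t \<ge> 1" by simp
    moreover have "t \<le> 2 * (a + b) + 2" using assms(6) by presburger
    ultimately show ?thesis by simp
  qed simp
  from gap_path[OF assms(1) _ this assms(3), of "2 * n + 1"] assms(2) obtain w
    where w: "w < 2 * n + 1" "matched gap ({..<2 * n + 1} - {w})
      (replicate_mset a 1 + replicate_mset b 2 + replicate_mset c t)" by auto
  have "\<exists>F. near_1_factor n F \<and> length_list (2 * n + 1) F =
      image_mset (\<lambda>l. l) (replicate_mset a 1 + replicate_mset b 2 + replicate_mset c t)"
    by (rule matched_embed_near_1_factor[OF w(2), where f = "\<lambda>i. i"])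
       (use w(1) assms in \<open>auto simp: gap_def split: if_splits\<close>)
  then show ?thesis by (simp add: realizable_def)
qed

text \<open>\<open>t\<close> is the quotient \<open>y / x\<close> modulo \<open>2 * n + 1\<close>,
  with the sign chosen so that it is at most \<open>n\<close>.\<close>

lemma coprime_multiplier:
  assumes "coprime x (2 * n + 1)" "1 \<le> y" "y \<le> n"
  shows "\<exists>t. 1 \<le> t \<and> t \<le> n \<and> ([int t * int x = int y] (mod int (2 * n + 1)) \<or>
    [int t * int x = - int y] (mod int (2 * n + 1)))"
proof -
  let ?v = "int (2 * n + 1)"
  have "coprime (int x) ?v" using assms(1) by (simp only: coprime_int_iff)
  then obtain s where s: "[int x * s = 1] (mod ?v)" using cong_solve_coprime_int by blast
  define r where "r = (s * int y) mod ?v"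
  have r: "0 \<le> r" "r < ?v" by (simp_all add: r_def)
  have "[r * int x = s * int y * int x] (mod ?v)" by (simp add: r_def cong_def mod_mult_left_eq)
  also have "s * int y * int x = int x * s * int y" by simp
  also have "[int x * s * int y = 1 * int y] (mod ?v)" using s by (rule cong_scalar_right)
  finally have rx: "[r * int x = int y] (mod ?v)" by simp
  have "r \<noteq> 0"
  proof
    assume "r = 0"
    with rx have "?v dvd int y" by (simp add: cong_iff_dvd_diff)
    then have "?v \<le> int y" using assms(2) by (intro zdvd_imp_le) auto
    with assms(3) show False by simp
  qed
  show ?thesis
  proof (cases "r \<le> int n")
    case True
    with r \<open>r \<noteq> 0\<close> rx show ?thesis by (intro exI[of _ "nat r"]) auto
  next
    case False
    have "[(?v - r) * int x = (0 - r) * int x] (mod ?v)"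
      by (intro cong_mult cong_diff cong_refl) (simp add: cong_def)
    also have "(0 - r) * int x = - (r * int x)" by simp
    also have "[- (r * int x) = - int y] (mod ?v)" using rx by (simp only: cong_minus_minus_iff)
    finally show ?thesis using False r by (intro exI[of _ "nat (?v - r)"]) auto
  qed
qed

lemma cong_mod_diff:
  "[int (A mod v) - int (B mod v) = int A - int B] (mod int v)"
  by (simp only: zmod_int cong_def mod_diff_eq)

text \<open>Along the path \<open>i * x\<close> an \<open>x\<close>-edge is a step by 1 and a
  \<open>y\<close>-edge a step by \<open>t\<close>. The bound on \<open>3 * b\<close> amounts to
  \<open>b \<le> 2 * a + 1\<close> and makes the partial block fit.\<close>

lemma realizable_coprime:
  assumes "coprime x (2 * n + 1)" "1 \<le> x" "x \<le> n" "1 \<le> y" "y \<le> n" "b = 0 \<or> x \<noteq> y"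
    and "a + b = n" "3 * b \<le> 2 * n + 1"
  shows "realizable n (replicate_mset a x + replicate_mset b y)"
proof -
  let ?v = "2 * n + 1"
  from coprime_multiplier[OF assms(1,4,5)] obtain t where t: "1 \<le> t" "t \<le> n"
    "[int t * int x = int y] (mod int ?v) \<or> [int t * int x = - int y] (mod int ?v)" by blast
  \<comment> \<open>The labels 1 and \<open>t\<close> must stay distinguishable, since they are
    decoded as \<open>x\<close> and \<open>y\<close>; \<open>t = 1\<close> would force
    \<open>x = y\<close>.\<close>
  have t1: "t \<noteq> 1" if "b \<noteq> 0"
  proof
    assume "t = 1"
    with t(3) have "int ?v dvd int x - int y \<or> int ?v dvd int x + int y"
      by (auto simp: cong_iff_dvd_diff)
    moreover have "\<bar>int x - int y\<bar> < int ?v" "int x + int y < int ?v" "int x + int y > 0"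
      using assms by auto
    ultimately have "x = y" using zdvd_imp_le[of "int ?v" "\<bar>int x - int y\<bar>"]
      zdvd_imp_le[of "int ?v" "int x + int y"] by fastforce
    with assms(6) that show False by simp
  qed
  \<comment> \<open>If \<open>b < t\<close>, the remainder is \<open>b\<close>, and
    \<open>2 * a + 1 + b = 2 * n + 1 - b\<close> exceeds \<open>n\<close>; otherwise
    \<open>t \<le> b \<le> 2 * a + 1\<close>.\<close>
  have "b mod t = 0 \<or> t \<le> 2 * (a + 0) + 1 + b mod t"
  proof (cases "b < t")
    case True
    then show ?thesis using assms t by simp
  next
    case False
    then show ?thesis using assms by simp
  qed
  from gap_path[OF _ _ this t(1), of ?v] assms(7) obtain w where w: "w < ?v"
    "matched gap ({..<?v} - {w}) (replicate_mset a 1 + replicate_mset b t)" by auto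
  let ?g = "\<lambda>l. if l = 1 then x else y"
  have g: "[int l * int x = int (?g l)] (mod int ?v) \<or> [int l * int x = - int (?g l)] (mod int ?v)"
    if "l \<in># replicate_mset a 1 + replicate_mset b t" for l
    using that t(3) t1 by (auto split: if_splits)
  have "\<exists>F. near_1_factor n F \<and> length_list ?v F =
      image_mset ?g (replicate_mset a 1 + replicate_mset b t)"
  proof (rule matched_embed_near_1_factor[OF w(2), where f = "\<lambda>i. (i * x) mod ?v"])
    show "w \<in> {..<?v}" using w(1) by simp
    show "inj_on (\<lambda>i. (i * x) mod ?v) {..<?v}"
    proof (rule inj_onI)
      fix i j assume *: "i \<in> {..<?v}" "j \<in> {..<?v}" "(i * x) mod ?v = (j * x) mod ?v"
      then have "[i * x = j * x] (mod ?v)" by (simp only: cong_def)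
      then have "[i = j] (mod ?v)" using assms(1) by (simp only: cong_mult_rcancel_nat)
      then show "i = j" using * by (simp add: cong_def)
    qed
    fix i j l
    assume l: "l \<in># replicate_mset a 1 + replicate_mset b t" and ij: "gap i j l"
    have main: "[int ((i' * x) mod ?v) - int ((j' * x) mod ?v) = int l * int x] (mod int ?v)"
      if "i' = j' + l" for i' j'
      using cong_mod_diff[of "i' * x" ?v "j' * x"] that by (simp add: algebra_simps)
    have neg: "[q - p = int k] (mod int ?v)" if "[p - q = - int k] (mod int ?v)" for p q k
      using that cong_minus_minus_iff[of "p - q" "- int k" "int ?v"] by simp
    have dir: "[int (i' * x mod ?v) - int (j' * x mod ?v) = int (?g l)] (mod int ?v) \<or>
        [int (j' * x mod ?v) - int (i' * x mod ?v) = int (?g l)] (mod int ?v)"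
      if "i' = j' + l" for i' j'
      using g[OF l] cong_trans[OF main[OF that]] neg by blast
    have "?g l \<le> n" using assms(3,5) by simp
    moreover from ij have "i = j + l \<or> j = i + l" by (auto simp: gap_def)
    ultimately show "?g l \<le> n \<and>
       ([int (i * x mod ?v) - int (j * x mod ?v) = int (?g l)] (mod int ?v) \<or>
        [int (j * x mod ?v) - int (i * x mod ?v) = int (?g l)] (mod int ?v))"
      using dir[of i j] dir[of j i] by blast
  qed auto
  moreover have "image_mset ?g (replicate_mset a 1 + replicate_mset b t) =
      replicate_mset a x + replicate_mset b y" using t1 by (cases "b = 0") auto
  ultimately show ?thesis by (simp add: realizable_def)
qed

text \<open>Modulo \<open>2 * g + 1\<close>, which divides \<open>x\<close> and is coprime to
  \<open>y\<close>, the residue of a cell determines its row; then \<open>x / (2 * g + 1)\<close>,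
  being coprime to \<open>m\<close>, determines its column.\<close>

lemma realizable_grid:
  assumes v: "2 * n + 1 = (2 * g + 1) * m" and d: "gcd x (2 * n + 1) = 2 * g + 1"
    and xy: "coprime y (2 * g + 1)" "1 \<le> x" "x \<le> n" "y \<le> n" "b = 0 \<or> 2 * y \<le> n"
    and g: "g \<ge> 1" and a: "a \<ge> 1" "g \<le> a + b"
    and ab: "even (a + b - g) \<and> a + b \<le> g * m \<or> a + b \<le> g * (m - 2) + 1"
  shows "realizable n (replicate_mset a y + replicate_mset b (2 * y) + replicate_mset (n - (a + b)) x)"
proof -
  let ?v = "2 * n + 1" and ?d = "2 * g + 1"
  have "odd ((2 * g + 1) * m)" using v by (metis even_plus_one_iff even_mult_iff even_numeral)
  then have m_odd: "odd m" by simp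
  have "?d \<le> n" using d xy(2,3) by (metis gcd_le1_nat le_trans not_one_le_zero)
  then have "m > 2" using v by (cases "m \<le> 2") (auto simp: le_Suc_eq numeral_2_eq_2)
  then have m: "m \<ge> 3" by simp
  let ?A = "{..<?d} \<times> {..<m}"
  from grid_near_matching[OF g m_odd m a ab] obtain w z where w: "w \<in> ?A"
    and M: "matched grid (?A - {w}) (replicate_mset a 1 + replicate_mset b 2 + replicate_mset z 0)"
    by blast
  have cardA: "card ?A = ?v" using v by (simp add: card_cartesian_product)
  \<comment> \<open>The grid matching leaves the number of horizontal edges open; counting cells
    fixes it.\<close>
  have "2 * n = 2 * (a + b + z)" using matched_card[OF M] w cardA by simp
  then have z: "z = n - (a + b)" by simp
  let ?f = "\<lambda>p. (fst p * y + snd p * x) mod ?v"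
  let ?g = "\<lambda>l::nat. if l = 0 then x else l * y"
  have "\<exists>F. near_1_factor n F \<and> length_list ?v F =
      image_mset ?g (replicate_mset a 1 + replicate_mset b 2 + replicate_mset z 0)"
  proof (rule matched_embed_near_1_factor[OF M w _ cardA, where f = ?f])
    show "inj_on ?f ?A"
    proof (rule inj_onI)
      fix p q assume p: "p \<in> ?A" and q: "q \<in> ?A" and eq: "?f p = ?f q"
      have eqv: "[fst p * y + snd p * x = fst q * y + snd q * x] (mod ?v)"
        using eq by (simp only: cong_def)
      have "?d dvd x" "?d dvd ?v" using d by (metis gcd_dvd1, metis gcd_dvd2)
      from eqv this(2) have "[fst p * y + snd p * x = fst q * y + snd q * x] (mod ?d)"
        by (rule cong_dvd_modulus_nat)
      moreover have "[fst r * y + snd r * x = fst r * y] (mod ?d)" for r :: "nat \<times> nat"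
        using \<open>?d dvd x\<close> by (simp add: cong_def mod_add_right_eq[symmetric, of _ "snd r * x"] del: mod_add_right_eq)
      ultimately have "[fst p * y = fst q * y] (mod ?d)"
        by (meson cong_sym cong_trans)
      then have "[fst p = fst q] (mod ?d)" using xy(1) by (simp only: cong_mult_rcancel_nat)
      then have fst: "fst p = fst q" using p q by (auto simp: cong_def)
      with eqv have xx: "[snd p * x = snd q * x] (mod ?v)" by (simp only: cong_add_lcancel_nat)
      obtain x' where x': "x = x' * ?d" using \<open>?d dvd x\<close> by (auto simp: dvd_def mult.commute)
      have "coprime x' m"
      proof -
        have "?d * gcd x' m = ?d * 1"
          using d unfolding v x' by (metis gcd_mult_distrib_nat mult.commute mult.right_neutral)
        then show ?thesis by (simp only: mult_left_cancel coprime_iff_gcd_eq_1)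
      qed
      have "(?d * (snd p * x')) mod (?d * m) = (?d * (snd q * x')) mod (?d * m)"
        using xx
        unfolding v x' cong_def by (simp only: mult.assoc mult.commute[of _ ?d] mult.left_commute[of _ ?d])
      then have "?d * (snd p * x' mod m) = ?d * (snd q * x' mod m)" by (simp only: mod_mult_mult1)
      then have "[snd p * x' = snd q * x'] (mod m)" unfolding cong_def mult_cancel1 by simp
      then have "[snd p = snd q] (mod m)" using \<open>coprime x' m\<close> by (simp only: cong_mult_rcancel_nat)
      then have "snd p = snd q" using p q by (auto simp: cong_def)
      with fst show "p = q" by (rule prod_eqI)
    qed
    fix p q l
    assume l: "l \<in># replicate_mset a 1 + replicate_mset b 2 + replicate_mset z 0" and pq: "grid p q l"
    have "l = 0 \<or> l = 1 \<or> l = 2 \<and> b \<noteq> 0" using l by (auto split: if_splits)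
    then have "?g l \<le> n" using xy(3,4,5) by auto
    moreover have main: "[int (?f p') - int (?f q') = int (?g l)] (mod int ?v)"
      if "(l = 0 \<and> fst p' = fst q' \<and> snd p' = snd q' + 1) \<or>
        (l \<noteq> 0 \<and> snd p' = snd q' \<and> fst p' = fst q' + l)" for p' q' :: "nat \<times> nat"
      using cong_mod_diff[of "fst p' * y + snd p' * x" ?v "fst q' * y + snd q' * x"] that
      by (auto simp: algebra_simps)
    have "[int (?f p) - int (?f q) = int (?g l)] (mod int ?v) \<or>
       [int (?f q) - int (?f p) = int (?g l)] (mod int ?v)"
      using main[of p q] main[of q p] pq unfolding grid_def gap_def by argo
    ultimately show "?g l \<le> n \<and>
      ([int (?f p) - int (?f q) = int (?g l)] (mod int ?v) \<or>
       [int (?f q) - int (?f p) = int (?g l)] (mod int ?v))" by blast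
  qed auto
  then show ?thesis by (simp add: realizable_def z)
qed

section \<open>Lists with two or three distinct lengths\<close>

lemma odd_divisor_bounds:
  fixes x n :: nat
  assumes "1 \<le> x" "x \<le> n" "gcd x (2 * n + 1) \<noteq> 1"
  obtains g m where "gcd x (2 * n + 1) = 2 * g + 1" "2 * n + 1 = (2 * g + 1) * m"
    "g \<ge> 1" "odd m" "m \<ge> 3"
proof -
  define d where "d = gcd x (2 * n + 1)"
  obtain m where m: "2 * n + 1 = d * m" using gcd_dvd2[of x "2 * n + 1"] by (auto simp: d_def dvd_def)
  then have "odd (d * m)" by (metis even_plus_one_iff even_mult_iff even_numeral)
  then have odd: "odd d" "odd m" by simp_all
  from odd(1) obtain g where g: "d = 2 * g + 1" by (rule oddE)
  have "d \<le> x" unfolding d_def using assms(1) by (intro gcd_le1_nat) auto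
  then have "m \<noteq> 1" using m assms(2) by auto
  with odd(2) have "m \<ge> 3" by (auto elim!: oddE)
  moreover have "g \<ge> 1" using assms(3) g by (cases g) (auto simp: d_def)
  ultimately show thesis using that[of g m] g m odd(2) by (simp add: d_def)
qed

text \<open>
  The last assumption selects, up to exchanging the two lengths, the cases in which the path along
  \<open>x\<close> or one of the two grids applies.
\<close>

lemma realizable_two_aux:
  assumes xy: "1 \<le> x" "x \<le> n" "1 \<le> y" "y \<le> n" "x \<noteq> y" and ab: "1 \<le> a" "1 \<le> b" "a + b = n"
    and gcd: "gcd (gcd x y) (2 * n + 1) = 1"
    and bounds: "2 * a + gcd x (2 * n + 1) \<le> 2 * n + 1" "2 * b + gcd y (2 * n + 1) \<le> 2 * n + 1"
    and cases: "gcd x (2 * n + 1) = 1 \<or> gcd y (2 * n + 1) \<noteq> 1 \<and> 2 * b \<le> n"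
  shows "realizable n (replicate_mset a x + replicate_mset b y)"
proof -
  let ?v = "2 * n + 1"
  have cop: "coprime y (gcd x ?v)" "coprime x (gcd y ?v)"
    using gcd by (simp_all add: coprime_iff_gcd_eq_1 gcd.assoc gcd.commute gcd.left_commute)
  have grid_x: ?thesis
    if "gcd x ?v = 2 * g + 1" "?v = (2 * g + 1) * m" "g \<ge> 1"
      "even (b - g) \<and> b \<le> g * m \<or> b \<le> g * (m - 2) + 1" for g m
  proof -
    \<comment> \<open>With \<open>y\<close> vertical, the divisor condition at
      \<open>gcd x ?v\<close> says exactly that there are at least \<open>g\<close> vertical
      edges.\<close>
    have "g \<le> b" using bounds(1) that(1) ab(3) by linarith
    then have "realizable n (replicate_mset b y + replicate_mset 0 (2 * y) + replicate_mset (n - (b + 0)) x)"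
      using that cop(1) xy ab by (intro realizable_grid[of n g m]) auto
    moreover have "n - b = a" using ab by simp
    ultimately show ?thesis by (simp add: add.commute)
  qed
  have grid_y: ?thesis
    if "gcd y ?v = 2 * g + 1" "?v = (2 * g + 1) * m" "g \<ge> 1"
      "even (a - g) \<and> a \<le> g * m \<or> a \<le> g * (m - 2) + 1" for g m
  proof -
    have "g \<le> a" using bounds(2) that(1) ab(3) by linarith
    then have "realizable n (replicate_mset a x + replicate_mset 0 (2 * x) + replicate_mset (n - (a + 0)) y)"
      using that cop(2) xy ab by (intro realizable_grid[of n g m]) auto
    moreover have "n - a = b" using ab by simp
    ultimately show ?thesis by simp
  qed
  show ?thesis
  proof (cases "gcd x ?v = 1")
    case True
    then have cx: "coprime x ?v" by (simp add: coprime_iff_gcd_eq_1)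
    show ?thesis
    proof (cases "3 * b \<le> ?v")
      case True
      with cx xy ab show ?thesis by (intro realizable_coprime) auto
    next
      case b: False
      \<comment> \<open>Now \<open>a\<close> is small, so the lengths exchange roles: a path along
        \<open>y\<close>, or a grid whose rows are cosets of \<open>y\<close>.\<close>
      then have a: "6 * a + 3 \<le> ?v" using ab by linarith
      show ?thesis
      proof (cases "gcd y ?v = 1")
        case True
        then have "coprime y ?v" by (simp add: coprime_iff_gcd_eq_1)
        then have "realizable n (replicate_mset b y + replicate_mset a x)"
          using a xy ab by (intro realizable_coprime) auto
        then show ?thesis by (simp add: add.commute)
      next
        case False
        from odd_divisor_bounds[OF xy(3,4) False] obtain g m where gm: "gcd y ?v = 2 * g + 1"
          "?v = (2 * g + 1) * m" "g \<ge> 1" "odd m" "m \<ge> 3" by blast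
        obtain k where k: "m = k + 3" using gm(5) that[of "m - 3"] by simp
        obtain h where h: "g = h + 1" using gm(3) that[of "g - 1"] by simp
        have "a \<le> g * (m - 2) + 1" using a unfolding gm(2) k h by (simp add: algebra_simps)
        with gm show ?thesis by (intro grid_y) auto
      qed
    qed
  next
    case False
    with cases have y: "gcd y ?v \<noteq> 1" and b: "2 * b \<le> n" by auto
    from odd_divisor_bounds[OF xy(1,2) False] obtain g m where gm: "gcd x ?v = 2 * g + 1"
      "?v = (2 * g + 1) * m" "g \<ge> 1" "odd m" "m \<ge> 3" by blast
    show ?thesis
    proof (cases "m = 3")
      case False
      with gm(4,5) have "m \<ge> 5" by (auto elim!: oddE)
      then obtain k where k: "m = k + 5" using that[of "m - 5"] by simp
      obtain h where h: "g = h + 1" using gm(3) that[of "g - 1"] by simp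
      have "4 * b \<le> 2 * n" using b by simp
      then have "4 * b + 1 \<le> (2 * g + 1) * m" using gm(2) by linarith
      then have "b \<le> g * (m - 2) + 1" unfolding k h by (simp add: algebra_simps)
      with gm show ?thesis by (intro grid_x) auto
    next
      \<comment> \<open>With three columns the capacity \<open>g + 1\<close> may be too small for
        \<open>b\<close>. But \<open>gcd y ?v\<close> is coprime to \<open>gcd x ?v\<close> and
        hence divides 3, so the grid for \<open>y\<close>, with three rows and
        \<open>2 * g + 1\<close> columns, applies.\<close>
      case m3: True
      have "coprime (gcd y ?v) (2 * g + 1)"
        using cop(1) unfolding gm(1) by (rule coprime_divisors[rotated 2]) auto
      moreover have "gcd y ?v dvd (2 * g + 1) * 3" using gm(2) m3 by (metis gcd_dvd2)
      ultimately have "gcd y ?v dvd 3" by (simp only: coprime_dvd_mult_right_iff)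
      moreover have "prime (3::nat)" by simp
      ultimately have e: "gcd y ?v = 2 * 1 + 1" using y by (auto simp: prime_nat_iff)
      have "2 * a + (2 * g + 1) \<le> 3 * (2 * g + 1)" using bounds(1) gm m3 by simp
      then have "a \<le> 2 * g + 1" by simp
      \<comment> \<open>At the extreme value \<open>a = 2 * g + 1\<close> the parity alternative
        applies; below it the other capacity is \<open>2 * g\<close>.\<close>
      then have "even (a - 1) \<and> a \<le> 1 * (2 * g + 1) \<or> a \<le> 1 * (2 * g + 1 - 2) + 1"
        using gm(3) by (cases "a = 2 * g + 1") auto
      with e gm m3 show ?thesis by (intro grid_y[of 1 "2 * g + 1"]) auto
    qed
  qed
qed

lemma realizable_two:
  assumes xy: "1 \<le> x" "x \<le> n" "1 \<le> y" "y \<le> n" "x \<noteq> y" and ab: "1 \<le> a" "1 \<le> b" "a + b = n"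
    and gcd: "gcd (gcd x y) (2 * n + 1) = 1"
    and bounds: "2 * a + gcd x (2 * n + 1) \<le> 2 * n + 1" "2 * b + gcd y (2 * n + 1) \<le> 2 * n + 1"
  shows "realizable n (replicate_mset a x + replicate_mset b y)"
proof (cases "gcd x (2 * n + 1) = 1 \<or> gcd y (2 * n + 1) \<noteq> 1 \<and> 2 * b \<le> n")
  case True
  then show ?thesis using assms by (intro realizable_two_aux) auto
next
  case False
  \<comment> \<open>If neither length is coprime to \<open>2 * n + 1\<close>, one of the two
    multiplicities is at most half of \<open>n\<close>, so exchanging the lengths covers the
    remaining cases.\<close>
  then have "gcd y (2 * n + 1) = 1 \<or> gcd x (2 * n + 1) \<noteq> 1 \<and> 2 * a \<le> n" using ab by auto
  then have "realizable n (replicate_mset b y + replicate_mset a x)"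
    using assms by (intro realizable_two_aux) (auto simp: gcd.commute)
  then show ?thesis by (simp add: add.commute)
qed

text \<open>When the path does not fit, \<open>t\<close> exceeds \<open>2 * (a + b)\<close>, so
  \<open>a + b\<close> is small against \<open>2 * n + 1\<close> and the grid with
  \<open>y = 1\<close> has room.\<close>

lemma realizable_one_two_noncoprime:
  assumes abc: "1 \<le> a" "1 \<le> b" "a + b + c = n" and t: "3 \<le> t" "t \<le> n" "\<not> coprime t (2 * n + 1)"
    and bound: "2 * c + gcd t (2 * n + 1) \<le> 2 * n + 1"
  shows "realizable n (replicate_mset a 1 + replicate_mset b 2 + replicate_mset c t)"
proof (cases "(t - 1) div 2 \<le> a + b")
  case True
  with assms show ?thesis by (intro realizable_one_two) auto
next
  case False
  then have h: "2 * (a + b) + 3 \<le> t" by presburger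
  let ?v = "2 * n + 1"
  have "gcd t ?v \<noteq> 1" using t(3) by (simp add: coprime_iff_gcd_eq_1)
  moreover have "1 \<le> t" using t(1) by simp
  ultimately obtain g m
    where gm: "gcd t ?v = 2 * g + 1" "?v = (2 * g + 1) * m" "g \<ge> 1" "odd m" "m \<ge> 3"
    using odd_divisor_bounds[of t n] t(2) by blast
  have gab: "g \<le> a + b" using bound gm(1) abc by linarith
  obtain k where k: "t = (2 * g + 1) * k" using gm(1) by (metis dvdE gcd_dvd1)
  have "k \<noteq> 0" using t(1) k by (intro notI) simp
  \<comment> \<open>\<open>t\<close> exceeds its divisor, as
    \<open>2 * g + 1 \<le> 2 * (a + b) + 1 < t\<close>. This rules out a grid with only three
    columns.\<close>
  moreover have "k \<noteq> 1" using k h gab by (intro notI) simp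
  ultimately have "k \<ge> 2" by simp
  have "(2 * g + 1) * (2 * k) < (2 * g + 1) * m" using t(2) gm(2) k by (simp add: algebra_simps)
  then have "2 * k < m" by (simp only: mult_less_cancel1)
  with \<open>k \<ge> 2\<close> obtain j where j: "m = j + 5" using that[of "m - 5"] by simp
  obtain i where i: "g = i + 1" using gm(3) that[of "g - 1"] by simp
  have "4 * (a + b) + 7 \<le> (2 * g + 1) * m" using h t(2) gm(2) by linarith
  then have "a + b \<le> g * (m - 2) + 1" unfolding i j by (simp add: algebra_simps)
  then have "realizable n (replicate_mset a 1 + replicate_mset b (2 * 1) + replicate_mset (n - (a + b)) t)"
    using gm gab abc t by (intro realizable_grid[of n g m]) auto
  moreover have "n - (a + b) = c" using abc by simp
  ultimately show ?thesis by simp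
qed

section \<open>The list of all lengths from 1 to \<open>n\<close>\<close>

lemma gap_reflection:
  assumes "k \<le> n"
  shows "matched gap ({n - k..n + k} - {n}) (image_mset (\<lambda>i. 2 * i) (mset_set {1..k}))"
  using assms
proof (induction k)
  case 0
  then show ?case by (simp add: matched.empty)
next
  case (Suc k)
  then have IH: "matched gap ({n - k..n + k} - {n}) (image_mset (\<lambda>i. 2 * i) (mset_set {1..k}))"
    by simp
  have "gap (n - Suc k) (n + Suc k) (2 * Suc k)" using Suc.prems by (simp add: gap_def)
  then have "matched gap (insert (n - Suc k) (insert (n + Suc k) ({n - k..n + k} - {n})))
      (add_mset (2 * Suc k) (image_mset (\<lambda>i. 2 * i) (mset_set {1..k})))"
    using Suc.prems by (intro matched.add IH) auto
  then show ?case
    by (rule matched_subst) (use Suc.prems in \<open>auto simp: atLeastAtMostSuc_conv\<close>)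
qed

text \<open>Reflection in the vertex \<open>n\<close> produces the differences \<open>2 * i\<close>;
  those above \<open>n\<close> have the odd lengths \<open>2 * n + 1 - 2 * i\<close>, so even and
  odd lengths together occur once each.\<close>

lemma realizable_all:
  "realizable n (mset_set {1..n})"
proof -
  let ?v = "2 * n + 1"
  let ?g = "\<lambda>l::nat. if l \<le> n then l else ?v - l"
  let ?M = "image_mset (\<lambda>i. 2 * i) (mset_set {1..n})"
  have "matched gap ({..<?v} - {n}) ?M"
    by (rule matched_subst[OF gap_reflection[OF le_refl, of n]]) auto
  then have "\<exists>F. near_1_factor n F \<and> length_list ?v F = image_mset ?g ?M"
  proof (rule matched_embed_near_1_factor[where f = "\<lambda>i. i"])
    have wrap: "[p = int ?v - q] (mod int ?v)" if "p = - q" for p q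
    proof -
      have "p - (int ?v - q) = - int ?v" using that by simp
      then show ?thesis by (simp only: cong_iff_dvd_diff dvd_minus_iff dvd_refl)
    qed
    fix x y l assume l: "l \<in># ?M" "gap x y l"
    then have "l \<le> 2 * n" "l \<ge> 1" by auto
    then have "?g l \<le> n" by auto
    moreover have "int (?g l) = int l \<or> int (?g l) = int ?v - int l" using \<open>l \<le> 2 * n\<close> by auto
    moreover have "int x - int y = int l \<or> int y - int x = int l" using l(2) by (auto simp: gap_def)
    moreover have "[int y - int x = int ?v - int l] (mod int ?v)" if "int x - int y = int l"
      by (rule wrap) (use that in simp)
    moreover have "[int x - int y = int ?v - int l] (mod int ?v)" if "int y - int x = int l"
      by (rule wrap) (use that in simp)
    ultimately show "?g l \<le> n \<and> ([int x - int y = int (?g l)] (mod int ?v) \<or>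
        [int y - int x = int (?g l)] (mod int ?v))"
      by (metis cong_refl)
  qed auto
  moreover have "image_mset ?g ?M = mset_set {1..n}"
  proof -
    have inj: "inj_on (\<lambda>i. ?g (2 * i)) {1..n}"
    proof (rule inj_onI)
      fix i j assume "i \<in> {1..n}" "j \<in> {1..n}" "?g (2 * i) = ?g (2 * j)"
      then show "i = j" by (simp split: if_splits; presburger)
    qed
    have "(\<lambda>i. ?g (2 * i)) ` {1..n} = {1..n}"
      using inj by (intro endo_inj_surj) (auto split: if_splits)
    then show ?thesis using image_mset_mset_set[OF inj] by (simp add: multiset.map_comp comp_def)
  qed
  ultimately show ?thesis by (simp add: realizable_def)
qed

section \<open>The equivalence for the listed cases\<close>

text \<open>Necessity is \<open>near_1_factor_divisor_bound\<close>, so only a realization under the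
  divisor condition remains, which is restated without division.\<close>

lemma MPP_I:
  assumes "(\<And>d. 0 < d \<Longrightarrow> d dvd 2 * n + 1 \<Longrightarrow> 2 * size {#x \<in># L. d dvd x#} + d \<le> 2 * n + 1)
    \<Longrightarrow> realizable n L"
  shows "MPP n L"
proof -
  have iff: "real k \<le> (real (2 * n + 1) - real d) / 2 \<longleftrightarrow> 2 * k + d \<le> 2 * n + 1" for k d :: nat
    by (simp add: field_simps flip: of_nat_add of_nat_mult) linarith
  show ?thesis
    unfolding MPP_def Let_def iff
    using assms near_1_factor_divisor_bound by (auto simp: realizable_def simp del: One_nat_def)
qed

theorem theorem2:
  fixes n v :: nat and L :: "nat multiset" and S :: "nat set"
  assumes "n \<ge> 1"
    and "size L = n"
    and "\<forall>x \<in># L. 1 \<le> x \<and> x \<le> n"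
    and "v = 2 * n + 1"
    and "S = set_mset L"
  shows "(card S = 1 \<or> card S = 2 \<or> card S = n \<longrightarrow> MPP n L) \<and>
    (\<forall>t \<ge> 3. S = {1, 2, t} \<and> \<not> coprime t v \<longrightarrow> MPP n L) \<and>
    (\<forall>t a b c. t \<ge> 3 \<and> a \<ge> 1 \<and> b \<ge> 1 \<and> c \<ge> 1 \<and> a + b + c = n \<and>
       L = replicate_mset a 1 + replicate_mset b 2 + replicate_mset c t \<and>
       int (a + b) \<ge> \<lfloor>(real t - 1) / 2\<rfloor> \<longrightarrow> MPP n L)"
proof (intro conjI impI allI)
  let ?C = "\<forall>d. 0 < d \<and> d dvd 2 * n + 1 \<longrightarrow> 2 * size {#x \<in># L. d dvd x#} + d \<le> 2 * n + 1"
  \<comment> \<open>The divisor condition at \<open>gcd x (2 * n + 1)\<close> counts at least all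
    copies of \<open>x\<close>.\<close>
  have count_bound: "2 * count L x + gcd x (2 * n + 1) \<le> 2 * n + 1" if C: ?C for x
  proof -
    have "replicate_mset (count L x) x \<subseteq># {#y \<in># L. gcd x (2 * n + 1) dvd y#}"
      by (auto simp: subseteq_mset_def)
    from size_mset_mono[OF this] C[rule_format, of "gcd x (2 * n + 1)"] show ?thesis by simp
  qed
  have one: "realizable n L" if C: ?C and S: "S = {x}" for x
  proof -
    have L: "L = replicate_mset n x" using assms(2,5) S by (metis set_mset_subset_singletonD subset_refl)
    \<comment> \<open>All \<open>n\<close> elements are copies of \<open>x\<close>, which leaves
      room only for a gcd of 1.\<close>
    then have "2 * n + gcd x (2 * n + 1) \<le> 2 * n + 1" using count_bound[OF C, of x] by simp
    then have "gcd x (2 * n + 1) \<le> 1" by simp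
    then have "coprime x (2 * n + 1)"
      by (metis coprime_iff_gcd_eq_1 gcd_eq_0_iff add_is_0 le_antisym less_one not_less zero_neq_one)
    then have "realizable n (replicate_mset n x + replicate_mset 0 x)"
      using assms(3,5) S by (intro realizable_coprime) auto
    with L show ?thesis by simp
  qed
  have two: "realizable n L" if C: ?C and S: "S = {x, y}" and "x \<noteq> y" for x y
  proof -
    have L: "L = replicate_mset (count L x) x + replicate_mset (count L y) y"
      using \<open>x \<noteq> y\<close> S assms(5) by (auto simp: multiset_eq_iff count_eq_zero_iff)
    have ab: "count L x \<ge> 1" "count L y \<ge> 1" "count L x + count L y = n"
      using S assms(5) L assms(2) by (auto simp: Suc_le_eq) (metis size_replicate_mset size_union)
    let ?d = "gcd (gcd x y) (2 * n + 1)"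
    have "?d dvd x" "?d dvd y" by (meson dvd_trans gcd_dvd1 gcd_dvd2)+
    \<comment> \<open>\<open>?d\<close> divides every element of the list, so the divisor condition
      at \<open>?d\<close> forces it to be 1.\<close>
    then have "{#z \<in># L. ?d dvd z#} = L" using S assms(5) by (simp add: filter_mset_eq_conv)
    with C[rule_format, of ?d] assms(2) have "?d \<le> 1" by simp
    then have "?d = 1" by (simp add: le_less)
    then show ?thesis
      using realizable_two[of x n y, OF _ _ _ _ \<open>x \<noteq> y\<close> ab _ count_bound[OF C] count_bound[OF C]] L S assms(3,5)
      by simp
  qed
  show "MPP n L" if cs: "card S = 1 \<or> card S = 2 \<or> card S = n"
  proof (rule MPP_I)
    assume "\<And>d. 0 < d \<Longrightarrow> d dvd 2 * n + 1 \<Longrightarrow> 2 * size {#x \<in># L. d dvd x#} + d \<le> 2 * n + 1"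
    then have C: ?C by blast
    from cs consider "card S = 1" | "card S = 2" | "card S = n" by blast
    then show "realizable n L"
    proof cases
      case 1
      then show ?thesis using one[OF C] by (auto simp: card_1_singleton_iff)
    next
      case 2
      then show ?thesis using two[OF C] by (auto simp: card_2_iff)
    next
      case 3
      \<comment> \<open>A list of \<open>n\<close> elements with \<open>n\<close> distinct values
        from 1 to \<open>n\<close> contains each of them exactly once.\<close>
      have "S \<subseteq> {1..n}" using assms(3,5) by auto
      with 3 have "S = {1..n}" by (intro card_subset_eq) auto
      moreover have "mset_set S \<subseteq># L" unfolding assms(5) by (rule mset_set_set_mset_msubset)
      moreover have "size (mset_set S) = size L" using 3 assms(2) by simp
      ultimately have "L = mset_set {1..n}" by (metis mset_subset_size subset_mset.le_less nat_neq_iff)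
      then show ?thesis using realizable_all by simp
    qed
  qed
  show "MPP n L" if t: "t \<ge> 3" "S = {1, 2, t} \<and> \<not> coprime t v" for t
  proof (rule MPP_I)
    assume "\<And>d. 0 < d \<Longrightarrow> d dvd 2 * n + 1 \<Longrightarrow> 2 * size {#x \<in># L. d dvd x#} + d \<le> 2 * n + 1"
    then have C: ?C by blast
    have L: "L = replicate_mset (count L 1) 1 + replicate_mset (count L 2) 2 + replicate_mset (count L t) t"
      using t assms(5) by (auto simp: multiset_eq_iff count_eq_zero_iff)
    then have "count L 1 + count L 2 + count L t = n"
      using assms(2) by (metis size_replicate_mset size_union)
    moreover have "count L 1 \<ge> 1" "count L 2 \<ge> 1" "t \<le> n"
      using t assms(3,5) by (auto simp: Suc_le_eq)
    ultimately show "realizable n L"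
      using realizable_one_two_noncoprime[of "count L 1" "count L 2" "count L t" n t]
        count_bound[OF C] t assms(4) L by simp
  qed
  show "MPP n L" if t: "t \<ge> 3 \<and> a \<ge> 1 \<and> b \<ge> 1 \<and> c \<ge> 1 \<and> a + b + c = n \<and>
       L = replicate_mset a 1 + replicate_mset b 2 + replicate_mset c t \<and>
       int (a + b) \<ge> \<lfloor>(real t - 1) / 2\<rfloor>" for t a b c
  proof (rule MPP_I)
    have "(real t - 1) / 2 = real (t - 1) / real 2" using t by (simp add: of_nat_diff)
    then have "\<lfloor>(real t - 1) / 2\<rfloor> = int ((t - 1) div 2)" by (simp only: floor_divide_of_nat_eq)
    then have "(t - 1) div 2 \<le> a + b" using t by simp
    moreover have "t \<le> n" using t assms(3) by auto
    ultimately show "realizable n L" using realizable_one_two[of a b c n t] t by simp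
  qed
qed

end
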